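(* Let $Q=T[H_1,\dots,H_t]$ be a semicomplete composition. Then $Q$ contains an acyclic spanning subdigraph $R$ with a source $x$ and a sink $y$ such that for each vertex $z$ of $Q$, $R$ contains an $x$--$z$ path and a $z$--$y$ path, if one of the following assertions holds: (a) $Q$ is non-strong and has both in- and out-branchings (i.e., at least one in-branching and at least one out-branching); (b) $Q$ is strong with $|V(H_i)|\ge 2$ for each $i\in\{1,\dots,t\}$.
   Context: Digraphs are finite, without loops or parallel arcs (2-cycles are allowed); paths and cycles are directed, and a single vertex is a (trivial) path. A digraph is semicomplete if there is at least one arc between every pair of distinct vertices. Let $T$ be a digraph with vertices $u_1,\dots,u_t$ ($t\ge 2$) and let $H_1,\dots,H_t$ be pairwise disjoint nonempty digraphs. The composition $Q=T[H_1,\dots,H_t]$ is the digraph with vertex set $\bigcup_i V(H_i)$ and arc set $\bigcup_{i=1}^t A(H_i)\cup\{xy : x\in V(H_i),\ y\in V(H_p),\ u_iu_p\in A(T)\}$. It is a semicomplete composition if $T$ is semicomplete. A digraph is strong if for every ordered pair of vertices $(x,y)$ there is a directed path from $x$ to $y$. A digraph is acyclic if it has no directed cycle (including 2-cycles). A source (resp. sink) is a vertex of in-degree zero (resp. out-degree zero). An out-tree (resp. in-tree) rooted at $r$ is an orientation of a tree in which every vertex except $r$ has in-degree (resp. out-degree) one. An out-branching (resp. in-branching) of $D$ is a spanning subdigraph of $D$ which is an out-tree (resp. in-tree). *)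

theory Defs
  imports "Graph_Theory.Digraph_Component"
begin

definition semicomplete :: "'a pair_pre_digraph \<Rightarrow> bool" where
  "semicomplete D \<longleftrightarrow>
     (\<forall>u\<in>pverts D. \<forall>v\<in>pverts D. u \<noteq> v \<longrightarrow> (u, v) \<in> parcs D \<or> (v, u) \<in> parcs D)"

text \<open>In the composition \<open>T[H\<^sub>1,\<dots>,H\<^sub>t]\<close> the family of digraphs is indexed by the vertices
  \<open>u\<^sub>1,\<dots>,u\<^sub>t\<close> of \<open>T\<close> themselves, so \<open>H u\<^sub>i\<close> stands for \<open>H\<^sub>i\<close>; the values of \<open>H\<close> outside
  \<open>pverts T\<close> are irrelevant.\<close>

definition composition ::
  "'u pair_pre_digraph \<Rightarrow> ('u \<Rightarrow> 'a pair_pre_digraph) \<Rightarrow> 'a pair_pre_digraph" where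
  "composition T H =
     \<lparr> pverts = (\<Union>u\<in>pverts T. pverts (H u)),
       parcs = (\<Union>u\<in>pverts T. parcs (H u)) \<union>
         {(x, y). \<exists>u v. (u, v) \<in> parcs T \<and> x \<in> pverts (H u) \<and> y \<in> pverts (H v)} \<rparr>"

locale semicomplete_composition =
  fixes T :: "'u pair_pre_digraph" and H :: "'u \<Rightarrow> 'a pair_pre_digraph"
  assumes digraph_T: "pair_digraph T"
    and semicomplete_T: "semicomplete T"
    and card_T: "card (pverts T) \<ge> 2"
    and digraph_H: "u \<in> pverts T \<Longrightarrow> pair_digraph (H u)"
    and nonempty_H: "u \<in> pverts T \<Longrightarrow> pverts (H u) \<noteq> {}"
    and disjoint_H: "\<lbrakk>u \<in> pverts T; v \<in> pverts T; u \<noteq> v\<rbrakk> \<Longrightarrow> pverts (H u) \<inter> pverts (H v) = {}"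

definition acyclic_digraph :: "'a pair_pre_digraph \<Rightarrow> bool" where
  "acyclic_digraph D \<longleftrightarrow> (\<nexists>c. pre_digraph.cycle (with_proj D) c)"

definition is_source :: "'a pair_pre_digraph \<Rightarrow> 'a \<Rightarrow> bool" where
  "is_source D x \<longleftrightarrow> x \<in> pverts D \<and> in_degree (with_proj D) x = 0"

definition is_sink :: "'a pair_pre_digraph \<Rightarrow> 'a \<Rightarrow> bool" where
  "is_sink D x \<longleftrightarrow> x \<in> pverts D \<and> out_degree (with_proj D) x = 0"

text \<open>The library constant \<open>tree\<close> only excludes directed cycles, so it does not express that
  the underlying undirected graph is a tree. The cycles of the underlying graph are the cycles of
  length at least 3 in the symmetric closure (a closed walk \<open>u, v, u\<close> there just traverses one
  edge back and forth). An orientation of a graph uses each edge in exactly one direction, which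
  excludes 2-cycles.\<close>

definition oriented_tree :: "'a pair_pre_digraph \<Rightarrow> bool" where
  "oriented_tree D \<longleftrightarrow>
     connected (with_proj D) \<and>
     (\<nexists>c. pre_digraph.cycle (with_proj (mk_symmetric (with_proj D))) c \<and> length c \<ge> 3) \<and>
     (\<forall>u v. (u, v) \<in> parcs D \<longrightarrow> (v, u) \<notin> parcs D)"

definition out_tree :: "'a pair_pre_digraph \<Rightarrow> 'a \<Rightarrow> bool" where
  "out_tree D r \<longleftrightarrow> oriented_tree D \<and> r \<in> pverts D \<and>
     (\<forall>v\<in>pverts D - {r}. in_degree (with_proj D) v = 1)"

definition in_tree :: "'a pair_pre_digraph \<Rightarrow> 'a \<Rightarrow> bool" where
  "in_tree D r \<longleftrightarrow> oriented_tree D \<and> r \<in> pverts D \<and>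
     (\<forall>v\<in>pverts D - {r}. out_degree (with_proj D) v = 1)"

definition out_branching :: "'a pair_pre_digraph \<Rightarrow> 'a pair_pre_digraph \<Rightarrow> bool" where
  "out_branching B D \<longleftrightarrow> spanning (with_proj B) (with_proj D) \<and> (\<exists>r. out_tree B r)"

definition in_branching :: "'a pair_pre_digraph \<Rightarrow> 'a pair_pre_digraph \<Rightarrow> bool" where
  "in_branching B D \<longleftrightarrow> spanning (with_proj B) (with_proj D) \<and> (\<exists>r. in_tree B r)"

end

theory Submission
  imports Defs
begin

text \<open>
  It suffices to find a potential \<open>f\<close> on the vertices such that every vertex except \<open>x\<close> has an
  in-neighbour of smaller potential and every vertex except \<open>y\<close> has an out-neighbour of larger
  potential: the arcs along which \<open>f\<close> increases then form \<open>R\<close>.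

  In case (a) let \<open>r\<close> be the root of an out-branching and \<open>s\<close> the root of an in-branching. As \<open>Q\<close>
  is not strong, neither is \<open>T\<close>, so the block of \<open>s\<close> does not reach the block of \<open>r\<close> in \<open>T\<close>.
  Hence \<open>r\<close> dominates every vertex outside the blocks that reach its own block, and dually for \<open>s\<close>.
  The blocks that reach the block of \<open>r\<close> are put first, ordered by the distance from \<open>r\<close>; those
  reached from the block of \<open>s\<close> are put last, ordered by decreasing distance to \<open>s\<close>.

  In case (b) \<open>T\<close> is strong. Fix two distinct vertices \<open>a\<close>, \<open>b\<close> of \<open>T\<close> and split every block into a
  nonempty lower and a nonempty upper part, such that the lower part of block \<open>a\<close> is \<open>{x}\<close> and the
  upper part of block \<open>b\<close> is \<open>{y}\<close>. All lower parts come first, ordered by the distance in \<open>T\<close> from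
  \<open>a\<close>; then come all upper parts, ordered by decreasing distance to \<open>b\<close>. Every vertex of \<open>T\<close> has an
  in- and an out-neighbour, so each lower vertex has an upper out-neighbour and each upper vertex
  a lower in-neighbour.
\<close>

section \<open>Reachability and distances from a root\<close>

lemma acyclic_root_reaches:
  assumes "finite E" "acyclic E" "v \<in> V"
    and pred: "\<And>v. v \<in> V \<Longrightarrow> v \<noteq> r \<Longrightarrow> \<exists>w\<in>V. (w, v) \<in> E"
  shows "(r, v) \<in> E\<^sup>*"
  using \<open>v \<in> V\<close>
\<comment> \<open>A finite acyclic relation is well-founded, so stepping back to predecessors
  terminates, and it can only stop at \<open>r\<close>.\<close>
proof (induction v rule: wf_induct_rule[OF finite_acyclic_wf[OF assms(1,2)]])
  case (1 v)
  show ?case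
  proof (cases "v = r")
    case False
    then obtain w where "w \<in> V" "(w, v) \<in> E" using pred "1.prems" by blast
    with "1.IH" show ?thesis by (meson rtrancl.rtrancl_into_rtrancl)
  qed simp
qed

text \<open>Take for \<open>d\<close> the length of a shortest walk from \<open>r\<close>: the last
  but one vertex of such a walk is closer. The bound \<open>M\<close> later serves to shift all
  values below zero.\<close>

lemma bounded_distance_exists:
  assumes "finite V"
  obtains d :: "'a \<Rightarrow> nat" and M where
    "\<And>v. v \<in> V \<Longrightarrow> d v < M"
    "\<And>v. (r, v) \<in> E\<^sup>* \<Longrightarrow> v \<noteq> r \<Longrightarrow> \<exists>w. (w, v) \<in> E \<and> d w < d v"
proof -
  \<comment> \<open>For \<open>v\<close> not reachable from \<open>r\<close> this value is
    unspecified; the bound on \<open>d\<close> only needs \<open>V\<close> to be finite.\<close>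
  define d where "d v = (LEAST n. (r, v) \<in> E ^^ n)" for v
  obtain M where M: "\<forall>n\<in>d ` V. n < M"
    using assms finite_nat_set_iff_bounded[of "d ` V"] by blast
  have "\<exists>w. (w, v) \<in> E \<and> d w < d v" if reach: "(r, v) \<in> E\<^sup>*" and "v \<noteq> r" for v
  proof -
    from reach have "\<exists>n. (r, v) \<in> E ^^ n" by (simp add: rtrancl_power)
    then have walk: "(r, v) \<in> E ^^ d v" unfolding d_def by (rule LeastI_ex)
    with \<open>v \<noteq> r\<close> obtain m where m: "d v = Suc m" by (cases "d v") auto
    with walk obtain w where "(r, w) \<in> E ^^ m" "(w, v) \<in> E" by auto
    moreover have "d w \<le> m" unfolding d_def by (rule Least_le) fact
    ultimately show ?thesis using m by auto
  qed
  with that M show ?thesis by blast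
qed

section \<open>Acyclicity and the roots of branchings\<close>

lemma acyclic_digraph_if_acyclic:
  assumes "pair_wf_digraph R" "acyclic (parcs R)"
  shows "acyclic_digraph R"
proof -
  interpret pair_wf_digraph R by fact
  show ?thesis unfolding acyclic_digraph_def cycle_def
    using assms(2) by (auto dest!: reachable1_awalkI simp: acyclic_def)
qed

text \<open>A directed cycle with at least three arcs is also a cycle of the symmetric closure,
  which a tree excludes. Loops and 2-cycles contradict that each edge is used in one direction
  only.\<close>

lemma oriented_tree_acyclic:
  assumes "pair_wf_digraph B" "oriented_tree B"
  shows "acyclic (parcs B)"
proof (rule ccontr)
  interpret pair_wf_digraph B by fact
  let ?S = "with_proj (mk_symmetric (with_proj B))"
  have noback: "(v, u) \<notin> parcs B" if "(u, v) \<in> parcs B" for u v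
    using assms(2) that by (auto simp: oriented_tree_def)
  assume "\<not> acyclic (parcs B)"
  then obtain u where "(u, u) \<in> (parcs B)\<^sup>+" by (auto simp: acyclic_def)
  then obtain q where "awalk u q u" "q \<noteq> []" by (auto simp: reachable1_awalk)
  then have "closed_w q" by (auto simp: closed_w_def)
  then obtain c where "cycle c" using closed_w_imp_cycle by blast
  then obtain v where v: "awalk v c v" "distinct (tl (pawalk_verts v c))" "c \<noteq> []"
    by (auto simp: cycle_def)
  have "length c \<ge> 3"
  proof (rule ccontr)
    assume "\<not> ?thesis"
    with \<open>c \<noteq> []\<close> consider e where "c = [e]" | e e' where "c = [e, e']"
      by (cases c rule: remdups_adj.cases) (auto simp: Suc_le_eq)
    then show False
    proof cases
      case 1
      with v(1) have "(v, v) \<in> parcs B" by (cases e) (auto simp: awalk_def)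
      with noback show False by blast
    next
      case 2
      with v(1) have "(fst e, snd e) \<in> parcs B" "(snd e, fst e) \<in> parcs B"
        by (cases e; cases e'; auto simp: awalk_def)+
      with noback show False by blast
    qed
  qed
  moreover have "pre_digraph.cycle ?S c"
    using v unfolding pre_digraph.cycle_def pre_digraph.awalk_def
    by (auto simp: mk_symmetric_def cas_with_proj_eq awalk_verts_with_proj_eq)
  ultimately show False using assms(2) by (auto simp: oriented_tree_def)
qed

text \<open>In-degree one supplies the predecessors that \<open>acyclic_root_reaches\<close> asks
  for. Reachability from the root is all that is kept of the branching.\<close>

lemma out_branching_reaches:
  assumes "out_branching B D" "finite (parcs D)"
  obtains r where "r \<in> pverts D" "\<And>v. v \<in> pverts D \<Longrightarrow> (r, v) \<in> (parcs D)\<^sup>*"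
proof -
  from assms(1) obtain r where r: "out_tree B r" and sub: "pverts D = pverts B"
    "parcs B \<subseteq> parcs D" "pair_wf_digraph B"
    by (auto simp: out_branching_def spanning_def subgraph_def wf_digraph_wp_iff)
  interpret pair_wf_digraph B by fact
  have "(r, v) \<in> (parcs B)\<^sup>*" if "v \<in> pverts B" for v
  proof (rule acyclic_root_reaches[OF _ _ that])
    show "finite (parcs B)" using sub(2) assms(2) by (rule finite_subset)
    show "acyclic (parcs B)"
      using r by (intro oriented_tree_acyclic sub) (auto simp: out_tree_def)
    fix w assume "w \<in> pverts B" "w \<noteq> r"
    with r have "card (in_arcs (with_proj B) w) = 1"
      by (auto simp: out_tree_def in_degree_def)
    then obtain e where "e \<in> in_arcs (with_proj B) w" by (metis card_1_singletonE insertI1)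
    then show "\<exists>u\<in>pverts B. (u, w) \<in> parcs B"
      by (cases e) (auto simp: in_arcs_def intro: in_arcsD1)
  qed
  then have "(r, v) \<in> (parcs D)\<^sup>*" if "v \<in> pverts D" for v
    using that rtrancl_mono[OF sub(2)] sub(1) by blast
  with that sub(1) r show ?thesis unfolding out_tree_def by blast
qed

text \<open>The argument for out-branchings, applied to the converse arc relation.\<close>

lemma in_branching_reaches:
  assumes "in_branching B D" "finite (parcs D)"
  obtains s where "s \<in> pverts D" "\<And>v. v \<in> pverts D \<Longrightarrow> (v, s) \<in> (parcs D)\<^sup>*"
proof -
  from assms(1) obtain s where s: "in_tree B s" and sub: "pverts D = pverts B"
    "parcs B \<subseteq> parcs D" "pair_wf_digraph B"
    by (auto simp: in_branching_def spanning_def subgraph_def wf_digraph_wp_iff)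
  interpret pair_wf_digraph B by fact
  have "(s, v) \<in> ((parcs B)\<inverse>)\<^sup>*" if "v \<in> pverts B" for v
  proof (rule acyclic_root_reaches[OF _ _ that])
    show "finite ((parcs B)\<inverse>)" using finite_subset[OF sub(2) assms(2)] by simp
    show "acyclic ((parcs B)\<inverse>)"
      unfolding acyclic_converse
      using s by (intro oriented_tree_acyclic sub) (auto simp: in_tree_def)
    fix w assume "w \<in> pverts B" "w \<noteq> s"
    with s have "card (out_arcs (with_proj B) w) = 1"
      by (auto simp: in_tree_def out_degree_def)
    then obtain e where "e \<in> out_arcs (with_proj B) w" by (metis card_1_singletonE insertI1)
    then show "\<exists>u\<in>pverts B. (u, w) \<in> (parcs B)\<inverse>"
      by (cases e) (auto simp: out_arcs_def intro: in_arcsD2)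
  qed
  then have "(v, s) \<in> (parcs D)\<^sup>*" if "v \<in> pverts D" for v
    using that rtrancl_mono[OF sub(2)] sub(1) by (auto simp: rtrancl_converse)
  with that sub(1) s show ?thesis unfolding in_tree_def by blast
qed

section \<open>Spanning acyclic subdigraphs from potentials\<close>

definition has_st_spanning :: "'a pair_pre_digraph \<Rightarrow> bool" where
  "has_st_spanning Q \<longleftrightarrow>
     (\<exists>R x y. spanning (with_proj R) (with_proj Q) \<and> acyclic_digraph R
     \<and> is_source R x \<and> is_sink R y
     \<and> (\<forall>z\<in>pverts Q. (\<exists>p. pre_digraph.apath (with_proj R) x p z)
                    \<and> (\<exists>p. pre_digraph.apath (with_proj R) z p y)))"

lemma has_st_spanning_if_potential:
  fixes f :: "'a \<Rightarrow> int"
  assumes "pair_fin_digraph Q" and xy: "x \<in> pverts Q" "y \<in> pverts Q"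
    and pred: "\<And>z. z \<in> pverts Q \<Longrightarrow> z \<noteq> x \<Longrightarrow> \<exists>w. (w, z) \<in> parcs Q \<and> f w < f z"
    and succ: "\<And>z. z \<in> pverts Q \<Longrightarrow> z \<noteq> y \<Longrightarrow> \<exists>w. (z, w) \<in> parcs Q \<and> f z < f w"
  shows "has_st_spanning Q"
proof -
  interpret Q: pair_fin_digraph Q by fact
  define R where "R = \<lparr>pverts = pverts Q, parcs = {(a, b) \<in> parcs Q. f a < f b}\<rparr>"
  have R: "pverts R = pverts Q" "(a, b) \<in> parcs R \<longleftrightarrow> (a, b) \<in> parcs Q \<and> f a < f b" for a b
    by (simp_all add: R_def)
  interpret R: pair_wf_digraph R
    by unfold_locales (auto simp: R_def dest: Q.in_arcsD1 Q.in_arcsD2)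
  have fin: "finite (parcs R)"
    by (rule finite_subset[OF _ Q.pair_finite_arcs]) (auto simp: R_def)
  have "f a < f b" if "(a, b) \<in> (parcs R)\<^sup>+" for a b
    using that by induction (auto simp: R)
  then have acyc: "acyclic (parcs R)" by (force simp: acyclic_def)
  have from_x: "(x, z) \<in> (parcs R)\<^sup>*" if "z \<in> pverts Q" for z
    by (rule acyclic_root_reaches[OF fin acyc that]) (use pred R Q.in_arcsD1 in blast)
  \<comment> \<open>In the converse of \<open>R\<close> the out-neighbours of larger potential
    become predecessors, so \<open>y\<close> takes the role of the root.\<close>
  have "(y, z) \<in> ((parcs R)\<inverse>)\<^sup>*" if "z \<in> pverts Q" for z
  proof (rule acyclic_root_reaches[OF _ _ that])
    show "\<exists>w\<in>pverts Q. (w, v) \<in> (parcs R)\<inverse>" if "v \<in> pverts Q" "v \<noteq> y" for v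
      using succ[OF that] R Q.in_arcsD2 by blast
  qed (use fin acyc in simp_all)
  then have to_y: "(z, y) \<in> (parcs R)\<^sup>*" if "z \<in> pverts Q" for z
    using that by (simp add: rtrancl_converse)
  have "spanning (with_proj R) (with_proj Q)"
    unfolding spanning_def subgraph_def
    using Q.wf_digraph_axioms R.wf_digraph_axioms by (auto simp: R_def)
  moreover have "acyclic_digraph R"
    using R.pair_wf_digraph_axioms acyc by (rule acyclic_digraph_if_acyclic)
  \<comment> \<open>An arc from \<open>w\<close> to \<open>x\<close> would close a cycle with the
    walk from \<open>x\<close> to \<open>w\<close>; the argument for \<open>y\<close> is
    dual.\<close>
  moreover have "(w, x) \<notin> parcs R" for w
    using from_x[of w] acyc R.in_arcsD1[of w x] R(1)
    by (metis acyclic_def rtrancl_into_trancl1)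
  then have "in_arcs (with_proj R) x = {}" by (auto simp: in_arcs_def)
  then have "is_source R x"
    using xy R(1) by (simp add: is_source_def in_degree_def)
  moreover have "(y, w) \<notin> parcs R" for w
    using to_y[of w] acyc R.in_arcsD2[of y w] R(1)
    by (metis acyclic_def rtrancl_into_trancl2)
  then have "out_arcs (with_proj R) y = {}" by (auto simp: out_arcs_def)
  then have "is_sink R y"
    using xy R(1) by (simp add: is_sink_def out_degree_def)
  moreover have "\<exists>p. R.apath x p z" "\<exists>p. R.apath z p y" if "z \<in> pverts Q" for z
    using from_x[OF that] to_y[OF that] that xy R(1)
    by (simp_all add: R.reachable_apath[symmetric] R.reachable_conv')
  ultimately show ?thesis unfolding has_st_spanning_def by blast
qed

section \<open>Walks in a composition and in its quotient\<close>

context semicomplete_composition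
begin

definition block :: "'a \<Rightarrow> 'u" where
  "block z = (THE u. u \<in> pverts T \<and> z \<in> pverts (H u))"

lemma block_eq: "u \<in> pverts T \<Longrightarrow> z \<in> pverts (H u) \<Longrightarrow> block z = u"
  unfolding block_def using disjoint_H by (intro the_equality) auto

lemma pverts_composition_iff:
  "z \<in> pverts (composition T H) \<longleftrightarrow> block z \<in> pverts T \<and> z \<in> pverts (H (block z))"
  by (auto simp: composition_def block_eq)

lemma composition_arcI:
  "z \<in> pverts (H u) \<Longrightarrow> w \<in> pverts (H v) \<Longrightarrow> (u, v) \<in> parcs T \<Longrightarrow> (z, w) \<in> parcs (composition T H)"
  by (auto simp: composition_def)

lemma T_arcD: "(u, v) \<in> parcs T \<Longrightarrow> u \<in> pverts T \<and> v \<in> pverts T"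
  using digraph_T by (auto simp: pair_digraph_def pair_fin_digraph_def pair_wf_digraph_def)

lemma finite_T: "finite (pverts T)"
  using digraph_T by (simp add: pair_digraph_def pair_fin_digraph_def pair_fin_digraph_axioms_def)

lemma H_arcD:
  assumes "u \<in> pverts T" "(z, w) \<in> parcs (H u)"
  shows "z \<in> pverts (H u)" "w \<in> pverts (H u)"
  using digraph_H[OF assms(1)] assms(2)
  by (auto simp: pair_digraph_def pair_fin_digraph_def pair_wf_digraph_def)

lemma composition_arcD:
  assumes "(z, w) \<in> parcs (composition T H)"
  shows "z \<in> pverts (composition T H)" "w \<in> pverts (composition T H)"
    "block z = block w \<or> (block z, block w) \<in> parcs T"
proof -
  from assms consider u where "u \<in> pverts T" "(z, w) \<in> parcs (H u)"
    | u v where "(u, v) \<in> parcs T" "z \<in> pverts (H u)" "w \<in> pverts (H v)"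
    by (auto simp: composition_def)
  then have "z \<in> pverts (composition T H) \<and> w \<in> pverts (composition T H) \<and>
    (block z = block w \<or> (block z, block w) \<in> parcs T)"
  proof cases
    case 1
    with H_arcD[OF 1] show ?thesis by (auto simp: composition_def block_eq)
  next
    case 2
    with T_arcD[OF 2(1)] show ?thesis by (auto simp: composition_def block_eq)
  qed
  then show "z \<in> pverts (composition T H)" "w \<in> pverts (composition T H)"
    "block z = block w \<or> (block z, block w) \<in> parcs T" by auto
qed

lemma composition_pair_fin_digraph: "pair_fin_digraph (composition T H)"
proof
  show fin: "finite (pverts (composition T H))"
    using finite_T digraph_H
    by (auto simp: composition_def pair_digraph_def pair_fin_digraph_def pair_fin_digraph_axioms_def)
  show "finite (parcs (composition T H))"
    by (rule finite_subset[OF _ finite_cartesian_product[OF fin fin]])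
      (auto dest: composition_arcD)
qed (auto dest: composition_arcD)

lemma composition_reachD:
  assumes "(z, w) \<in> (parcs (composition T H))\<^sup>*"
  shows "(block z, block w) \<in> (parcs T)\<^sup>*"
  using assms
  by induction (auto dest!: composition_arcD(3) intro: rtrancl_into_rtrancl)

text \<open>Walks of \<open>T\<close> lift vertex by vertex because blocks are nonempty. The walk
  must have positive length: for \<open>u = v\<close> an empty walk in \<open>T\<close> says nothing
  about two vertices of the same block.\<close>

lemma composition_reachI:
  assumes "(u, v) \<in> (parcs T)\<^sup>+" "z \<in> pverts (H u)" "w \<in> pverts (H v)"
  shows "(z, w) \<in> (parcs (composition T H))\<^sup>+"
  using assms(1,3)
proof (induction arbitrary: w)
  case (base v)
  then show ?case using composition_arcI[OF assms(2)] by blast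
next
  case (step v v')
  obtain w' where "w' \<in> pverts (H v)" using nonempty_H T_arcD[OF step(2)] by blast
  with step show ?case by (meson composition_arcI trancl_into_trancl)
qed

lemma other_T_vertex: "\<exists>v\<in>pverts T. v \<noteq> u"
proof (rule ccontr)
  assume "\<not> ?thesis"
  then have "pverts T \<subseteq> {u}" by blast
  from card_mono[OF _ this] card_T show False by simp
qed

lemma strongly_connected_composition:
  assumes strong: "\<And>u v. u \<in> pverts T \<Longrightarrow> v \<in> pverts T \<Longrightarrow> (u, v) \<in> (parcs T)\<^sup>*"
  shows "strongly_connected (with_proj (composition T H))"
proof
  interpret Q: pair_fin_digraph "composition T H" by (rule composition_pair_fin_digraph)
  obtain u where "u \<in> pverts T" using other_T_vertex by blast
  with nonempty_H show "verts (with_proj (composition T H)) \<noteq> {}"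
    by (auto simp: composition_def)
  fix z w
  assume zw: "z \<in> verts (with_proj (composition T H))" "w \<in> verts (with_proj (composition T H))"
  \<comment> \<open>The detour through \<open>v\<close> makes the walk in \<open>T\<close> nonempty
    even if \<open>z\<close> and \<open>w\<close> share a block.\<close>
  obtain v where "v \<in> pverts T" "v \<noteq> block z" using other_T_vertex by blast
  then have "(block z, v) \<in> (parcs T)\<^sup>+" "(v, block w) \<in> (parcs T)\<^sup>*"
    using zw strong by (auto simp: pverts_composition_iff dest: rtranclD)
  then have "(block z, block w) \<in> (parcs T)\<^sup>+" by simp
  with zw have "(z, w) \<in> (parcs (composition T H))\<^sup>+"
    by (auto simp: pverts_composition_iff intro: composition_reachI)
  then show "z \<rightarrow>\<^sup>*\<^bsub>with_proj (composition T H)\<^esub> w" by (rule Q.reachable1_reachable)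
qed

text \<open>Semicompleteness gives an arc of \<open>T\<close> between the two blocks, and only one
  direction remains possible.\<close>

lemma cross_arc:
  assumes "z \<in> pverts (composition T H)" "w \<in> pverts (composition T H)"
    "block z \<noteq> block w" "(block w, block z) \<notin> parcs T"
  shows "(z, w) \<in> parcs (composition T H)"
  using assms semicomplete_T
  by (auto simp: pverts_composition_iff semicomplete_def intro: composition_arcI)

section \<open>The non-strong case\<close>

lemma has_st_spanning_nonstrong:
  assumes nonstrong: "\<not> strongly_connected (with_proj (composition T H))"
    and "in_branching B (composition T H)" "out_branching B' (composition T H)"
  shows "has_st_spanning (composition T H)"
proof -
  let ?Q = "composition T H"
  interpret Q: pair_fin_digraph ?Q by (rule composition_pair_fin_digraph)
  obtain s where s: "s \<in> pverts ?Q" "\<And>v. v \<in> pverts ?Q \<Longrightarrow> (v, s) \<in> (parcs ?Q)\<^sup>*"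
    by (rule in_branching_reaches[OF assms(2) Q.pair_finite_arcs]) blast
  obtain r where r: "r \<in> pverts ?Q" "\<And>v. v \<in> pverts ?Q \<Longrightarrow> (r, v) \<in> (parcs ?Q)\<^sup>*"
    by (rule out_branching_reaches[OF assms(3) Q.pair_finite_arcs]) blast
  have reach_T: "(block r, u) \<in> (parcs T)\<^sup>*" "(u, block s) \<in> (parcs T)\<^sup>*" if u: "u \<in> pverts T" for u
  proof -
    obtain z where "z \<in> pverts (H u)" using nonempty_H u by blast
    then have "z \<in> pverts ?Q" "block z = u" using u by (auto simp: block_eq composition_def)
    then show "(block r, u) \<in> (parcs T)\<^sup>*" "(u, block s) \<in> (parcs T)\<^sup>*"
      using r s composition_reachD by blast+
  qed
  \<comment> \<open>Otherwise every \<open>u\<close> would reach \<open>block s\<close>, then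
    \<open>block r\<close>, then every \<open>v\<close>, so that \<open>T\<close> and hence the
    composition would be strong.\<close>
  have sr: "(block s, block r) \<notin> (parcs T)\<^sup>*"
  proof
    assume "(block s, block r) \<in> (parcs T)\<^sup>*"
    with reach_T have "(u, v) \<in> (parcs T)\<^sup>*" if "u \<in> pverts T" "v \<in> pverts T" for u v
      using that by (meson rtrancl_trans)
    with nonstrong strongly_connected_composition show False by blast
  qed
  define first where "first z \<longleftrightarrow> (block z, block r) \<in> (parcs T)\<^sup>*" for z
  define last where "last z \<longleftrightarrow> (block s, block z) \<in> (parcs T)\<^sup>*" for z
  have first_r: "first r" and last_s: "last s" by (simp_all add: first_def last_def)
  have disj: "\<not> (first z \<and> last z)" for z
    using sr by (auto simp: first_def last_def dest: rtrancl_trans)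
  \<comment> \<open>Hence the predecessor of \<open>z\<close> on a shortest walk from
    \<open>r\<close> stays in \<open>first\<close>, where \<open>f\<close> follows
    \<open>d\<close>.\<close>
  have first_closed: "first w" if "(w, z) \<in> parcs ?Q" "first z" for w z
    using composition_arcD(3)[OF that(1)] that(2)
    by (auto simp: first_def intro: converse_rtrancl_into_rtrancl)
  have last_closed: "last w" if "(z, w) \<in> parcs ?Q" "last z" for w z
    using composition_arcD(3)[OF that(1)] that(2)
    by (auto simp: last_def intro: rtrancl_into_rtrancl)
  \<comment> \<open>As \<open>block z\<close> does not reach \<open>block r\<close>, the blocks
    differ and no arc of \<open>T\<close> leads back.\<close>
  have from_r: "(r, z) \<in> parcs ?Q" if "z \<in> pverts ?Q" "\<not> first z" for z
    using that r(1) by (intro cross_arc) (auto simp: first_def)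
  have to_s: "(z, s) \<in> parcs ?Q" if "z \<in> pverts ?Q" "\<not> last z" for z
    using that s(1) by (intro cross_arc) (auto simp: last_def)
  obtain d M where d: "\<And>v. v \<in> pverts ?Q \<Longrightarrow> d v < (M::nat)"
    "\<And>v. (r, v) \<in> (parcs ?Q)\<^sup>* \<Longrightarrow> v \<noteq> r \<Longrightarrow> \<exists>w. (w, v) \<in> parcs ?Q \<and> d w < d v"
    by (rule bounded_distance_exists[OF Q.pair_finite_verts]) blast
  obtain d' M' where d': "\<And>v. v \<in> pverts ?Q \<Longrightarrow> d' v < (M'::nat)"
    "\<And>v. (s, v) \<in> ((parcs ?Q)\<inverse>)\<^sup>* \<Longrightarrow> v \<noteq> s \<Longrightarrow> \<exists>w. (w, v) \<in> (parcs ?Q)\<inverse> \<and> d' w < d' v"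
    by (rule bounded_distance_exists[OF Q.pair_finite_verts]) blast
  \<comment> \<open>The strict bounds make \<open>f\<close> negative on \<open>first\<close> and
    positive on \<open>last\<close>. All other vertices get 0 and are served by the arcs from
    \<open>r\<close> and to \<open>s\<close>.\<close>
  define f where "f z = (if first z then int (d z) - int M
    else if last z then int M' - int (d' z) else 0)" for z
  have f_first: "f z = int (d z) - int M" if "first z" for z using that by (simp add: f_def)
  have f_last: "f z = int M' - int (d' z)" if "last z" for z using that disj by (auto simp: f_def)
  have f_neg: "f z < 0" if "first z" "z \<in> pverts ?Q" for z using f_first d(1) that by force
  have f_pos: "f z > 0" if "last z" "z \<in> pverts ?Q" for z using f_last d'(1) that by force
  have f_nonneg: "f z \<ge> 0" if "\<not> first z" "z \<in> pverts ?Q" for z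
    using f_pos[OF _ that(2)] that(1) by (cases "last z") (auto simp: f_def)
  have f_nonpos: "f z \<le> 0" if "\<not> last z" "z \<in> pverts ?Q" for z
    using f_neg[OF _ that(2)] that(1) by (cases "first z") (auto simp: f_def)
  show ?thesis
  proof (rule has_st_spanning_if_potential[OF composition_pair_fin_digraph r(1) s(1), of f])
    fix z assume z: "z \<in> pverts ?Q" "z \<noteq> r"
    show "\<exists>w. (w, z) \<in> parcs ?Q \<and> f w < f z"
    proof (cases "first z")
      case True
      obtain w where w: "(w, z) \<in> parcs ?Q" "d w < d z" using d(2) r(2) z by blast
      with True first_closed show ?thesis by (intro exI[of _ w]) (auto simp: f_first)
    next
      case False
      with from_r z f_nonneg f_neg[OF first_r r(1)] show ?thesis by (intro exI[of _ r]) force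
    qed
  next
    fix z assume z: "z \<in> pverts ?Q" "z \<noteq> s"
    show "\<exists>w. (z, w) \<in> parcs ?Q \<and> f z < f w"
    proof (cases "last z")
      case True
      have "(s, z) \<in> ((parcs ?Q)\<inverse>)\<^sup>*" using s(2) z by (simp add: rtrancl_converse)
      with d'(2) z obtain w where w: "(z, w) \<in> parcs ?Q" "d' w < d' z" by blast
      with True last_closed show ?thesis by (intro exI[of _ w]) (auto simp: f_last)
    next
      case False
      with to_s z f_nonpos f_pos[OF last_s s(1)] show ?thesis by (intro exI[of _ s]) force
    qed
  qed
qed

section \<open>The strong case\<close>

lemma has_st_spanning_strong:
  assumes strong: "strongly_connected (with_proj (composition T H))"
    and card: "\<And>u. u \<in> pverts T \<Longrightarrow> card (pverts (H u)) \<ge> 2"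
  shows "has_st_spanning (composition T H)"
proof -
  let ?Q = "composition T H"
  interpret Q: pair_fin_digraph ?Q by (rule composition_pair_fin_digraph)
  have strong_T: "(u, v) \<in> (parcs T)\<^sup>*" if uv: "u \<in> pverts T" "v \<in> pverts T" for u v
  proof -
    obtain z w where "z \<in> pverts (H u)" "w \<in> pverts (H v)" using uv[THEN nonempty_H] by blast
    with uv have "z \<in> pverts ?Q" "w \<in> pverts ?Q" "block z = u" "block w = v"
      by (auto simp: block_eq composition_def)
    with strong show ?thesis
      by (metis composition_reachD reachable_rtranclI strongly_connected_def with_proj_simps(1,3))
  qed
  have out_T: "\<exists>v. (u, v) \<in> parcs T" and in_T: "\<exists>v. (v, u) \<in> parcs T" if u: "u \<in> pverts T" for u
  proof -
    obtain v where "v \<in> pverts T" "v \<noteq> u" using other_T_vertex by blast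
    then have "(u, v) \<in> (parcs T)\<^sup>+" "(v, u) \<in> (parcs T)\<^sup>+"
      using strong_T u by (auto dest: rtranclD)
    then show "\<exists>v. (u, v) \<in> parcs T" "\<exists>v. (v, u) \<in> parcs T" by (meson tranclD tranclD2)+
  qed
  obtain b where b: "b \<in> pverts T" using other_T_vertex by blast
  obtain a where a: "a \<in> pverts T" "a \<noteq> b" using other_T_vertex by blast
  define c where "c u = (SOME z. z \<in> pverts (H u))" for u
  have c: "c u \<in> pverts (H u)" if "u \<in> pverts T" for u
    unfolding c_def using nonempty_H[OF that] by (simp add: some_in_eq)
  have other: "\<exists>z\<in>pverts (H u). z \<noteq> c u" if u: "u \<in> pverts T" for u
  proof (rule ccontr)
    assume "\<not> ?thesis"
    then have "pverts (H u) \<subseteq> {c u}" by blast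
    from card_mono[OF _ this] card[OF u] show False by simp
  qed
  \<comment> \<open>In each block other than \<open>b\<close> the chosen vertex is the only low one;
    in block \<open>b\<close> it is the only high one. Thus \<open>c a\<close> and
    \<open>c b\<close> can serve as source and sink, and blocks of size at least two have both parts
    nonempty.\<close>
  define low where "low z \<longleftrightarrow> (if block z = b then z \<noteq> c b else z = c (block z))" for z
  have low_ex: "\<exists>z\<in>pverts (H u). low z" and high_ex: "\<exists>z\<in>pverts (H u). \<not> low z"
    if "u \<in> pverts T" for u
    using other[OF that] c[OF that] block_eq[OF that] by (auto simp: low_def)
  obtain d M where d: "\<And>v. v \<in> pverts T \<Longrightarrow> d v < (M::nat)"
    "\<And>v. (a, v) \<in> (parcs T)\<^sup>* \<Longrightarrow> v \<noteq> a \<Longrightarrow> \<exists>w. (w, v) \<in> parcs T \<and> d w < d v"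
    by (rule bounded_distance_exists[OF finite_T]) blast
  obtain d' M' where d': "\<And>v. v \<in> pverts T \<Longrightarrow> d' v < (M'::nat)"
    "\<And>v. (b, v) \<in> ((parcs T)\<inverse>)\<^sup>* \<Longrightarrow> v \<noteq> b \<Longrightarrow> \<exists>w. (w, v) \<in> (parcs T)\<inverse> \<and> d' w < d' v"
    by (rule bounded_distance_exists[OF finite_T]) blast
  define f where "f z = (if low z then int (d (block z)) - int M
    else int M' - int (d' (block z)))" for z
  have f_low: "f z < 0" if "low z" "block z \<in> pverts T" for z using d(1) that by (force simp: f_def)
  have f_high: "f z > 0" if "\<not> low z" "block z \<in> pverts T" for z
    using d'(1) that by (force simp: f_def)
  have xy: "c a \<in> pverts ?Q" "c b \<in> pverts ?Q"
    using a b c by (auto simp: composition_def)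
  show ?thesis
  proof (rule has_st_spanning_if_potential[OF composition_pair_fin_digraph xy, of f])
    fix z assume z: "z \<in> pverts ?Q" "z \<noteq> c a"
    then have zT: "block z \<in> pverts T" "z \<in> pverts (H (block z))" by (auto simp: pverts_composition_iff)
    show "\<exists>w. (w, z) \<in> parcs ?Q \<and> f w < f z"
    proof (cases "low z")
      case True
      \<comment> \<open>Since \<open>a\<close> differs from \<open>b\<close>, the only low vertex of
        block \<open>a\<close> is \<open>c a\<close>.\<close>
      with z a have "block z \<noteq> a" by (auto simp: low_def)
      with d(2) strong_T a zT obtain v where v: "(v, block z) \<in> parcs T" "d v < d (block z)" by blast
      then have vT: "v \<in> pverts T" using T_arcD by blast
      with low_ex obtain w where w: "w \<in> pverts (H v)" "low w" by blast
      with vT have "block w = v" by (simp add: block_eq)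
      with v w zT True show ?thesis
        by (intro exI[of _ w]) (auto simp: f_def intro: composition_arcI)
    next
      case False
      \<comment> \<open>Any in-neighbour of the block will do: low vertices have negative and high
        ones positive potential, whatever the distances.\<close>
      obtain v where v: "(v, block z) \<in> parcs T" using in_T zT by blast
      then have vT: "v \<in> pverts T" using T_arcD by blast
      with low_ex obtain w where w: "w \<in> pverts (H v)" "low w" by blast
      with vT have "block w = v" by (simp add: block_eq)
      with f_low[OF w(2)] vT f_high[OF False zT(1)] v w zT show ?thesis
        by (intro exI[of _ w]) (auto intro: composition_arcI)
    qed
  next
    fix z assume z: "z \<in> pverts ?Q" "z \<noteq> c b"
    then have zT: "block z \<in> pverts T" "z \<in> pverts (H (block z))" by (auto simp: pverts_composition_iff)
    show "\<exists>w. (z, w) \<in> parcs ?Q \<and> f z < f w"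
    proof (cases "low z")
      case False
      with z have "block z \<noteq> b" by (auto simp: low_def)
      moreover have "(b, block z) \<in> ((parcs T)\<inverse>)\<^sup>*"
        using strong_T b zT by (simp add: rtrancl_converse)
      ultimately obtain v where v: "(block z, v) \<in> parcs T" "d' v < d' (block z)"
        using d'(2) by blast
      then have vT: "v \<in> pverts T" using T_arcD by blast
      with high_ex obtain w where w: "w \<in> pverts (H v)" "\<not> low w" by blast
      with vT have "block w = v" by (simp add: block_eq)
      with v w zT False show ?thesis
        by (intro exI[of _ w]) (auto simp: f_def intro: composition_arcI)
    next
      case True
      obtain v where v: "(block z, v) \<in> parcs T" using out_T zT by blast
      then have vT: "v \<in> pverts T" using T_arcD by blast
      with high_ex obtain w where w: "w \<in> pverts (H v)" "\<not> low w" by blast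
      with vT have "block w = v" by (simp add: block_eq)
      with f_high[OF w(2)] vT f_low[OF True zT(1)] v w zT show ?thesis
        by (intro exI[of _ w]) (auto intro: composition_arcI)
    qed
  qed
qed

end

theorem theorem6p2:
  fixes T :: "'u pair_pre_digraph" and H :: "'u \<Rightarrow> 'a pair_pre_digraph"
    and Q :: "'a pair_pre_digraph"
  assumes "semicomplete_composition T H"
    and "Q = composition T H"
    and "(\<not> strongly_connected (with_proj Q) \<and> (\<exists>B. in_branching B Q) \<and> (\<exists>B. out_branching B Q))
       \<or> (strongly_connected (with_proj Q) \<and> (\<forall>u\<in>pverts T. card (pverts (H u)) \<ge> 2))"
  shows "\<exists>R x y. spanning (with_proj R) (with_proj Q) \<and> acyclic_digraph R
     \<and> is_source R x \<and> is_sink R y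
     \<and> (\<forall>z\<in>pverts Q. (\<exists>p. pre_digraph.apath (with_proj R) x p z)
                    \<and> (\<exists>p. pre_digraph.apath (with_proj R) z p y))"
proof -
  interpret semicomplete_composition T H by fact
  have "has_st_spanning Q"
    using assms(2,3) has_st_spanning_nonstrong has_st_spanning_strong by blast
  then show ?thesis unfolding has_st_spanning_def .
qed

end
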